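(* Let $\langle AR, VA, ATT\rangle$ be a block with $AR=\{A_1,\ldots,A_n\}$ and $VA=\{V_1,\ldots,V_m\}$ (all distinct), and regard all these arguments as variables. Let $$\mathbf{E}=\Big\{A_i\equiv\bigwedge_{(X,A_i)\in ATT}\neg X \;\Big|\; 1\le i\le n\Big\}[A_1][A_2]\cdots[A_n].$$ Then the local allocator $E_l$ defined by $E_l(A_i)=\mathrm{RE}(\mathbf{E}(A_i))$ for $1\le i\le n$ and $E_l(V_j)=V_j$ for $1\le j\le m$ is a general local allocator for the block.
   Context: **Expressions.** Three-valued logical expressions are $p ::= T\mid F\mid U\mid x\mid \neg p\mid p\land p\mid p\lor p$, $x$ a variable; $\land$ is often written as juxtaposition. A valuation is a map $v$ from variables to $\{T,F,U\}$; $[\![p]\!]_v$ is the evaluation in Kleene's strong three-valued logic: with $F<U<T$, $\land$ is min, $\lor$ is max, $\neg$ swaps $T$ and $F$ and fixes $U$, constants evaluate to themselves, $[\![x]\!]_v=v(x)$. $p\equiv q$ (equivalence) means $[\![p]\!]_v=[\![q]\!]_v$ for all $v$. $p[p'/x]$ is the substitution of $p'$ for $x$ in $p$. An empty conjunction is $T$. **Blocks and local allocators.** A block is a triple $\langle AR,VA,ATT\rangle$ with $AR,VA$ finite disjoint sets of arguments and $ATT\subseteq(AR\cup VA)\times AR$; elements of $AR$ are actual arguments and elements of $VA$ are variable arguments. A local allocator is a map from $AR\cup VA$ to expressions. It is complete iff (i) it sends each variable argument to a variable, distinct variable arguments to distinct variables, and (ii) $E_l(A)\equiv\bigwedge_{(A',A)\in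 ATT}\neg E_l(A')$ for each $A\in AR$. A local allocator is constant iff all its values are logical constants in $\{T,F,U\}$ and it satisfies (ii) for each $A\in AR$. A complete local allocator $E_l$ is general iff for every constant local allocator $E'_l$ there is a valuation $v$ with $E'_l(A)=[\![E_l(A)]\!]_v$ for all $A\in AR\cup VA$. **Variable equation sets.** A variable equation is a formal equation $X\equiv G$ with $X$ a variable and $G$ an expression; $\mathrm{LV}(X\equiv G)=X$, $\mathrm{RE}(X\equiv G)=G$. A variable equation set $\mathbf{E}$ is a set of variable equations with pairwise distinct left-hand variables; $\mathbf{E}(X)$ is the equation in $\mathbf{E}$ with left-hand variable $X$. **The transformation $\mathcal{R}_x$.** For quadruples of expressions $Q_i=(P_i,N_i,C_i,M_i)$, $i=1,2$, put $Q_1\sqcup Q_2=(P_1\lor P_2,\,N_1\lor N_2,\,C_1\lor C_2,\,M_1\lor M_2)$ and $Q_1\sqcap Q_2=(P_1P_2\lor P_1M_2\lor P_2M_1,\; N_1N_2\lor N_1M_2\lor N_2M_1,\; (P_1\lor N_1\lor M_1)C_2\lor(P_2\lor N_2\lor M_2)C_1\lor C_1C_2\lor P_1N_2\lor N_1P_2,\; M_1M_2)$. For a variable $x$, define $\mathcal{R}_x,\overline{\mathcal{R}}_x$ by mutual recursion ($c$ a logical constant, $y\ne x$ a variable): $\mathcal{R}_x(c)=(F,F,F,c)$, $\mathcal{R}_x(x)=(T,F,F,F)$, $\mathcal{R}_x(y)=(F,F,F,y)$, $\mathcal{R}_x(\neg p)=\overline{\mathcal{R}}_x(p)$, $\mathcal{R}_x(p_1\lor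 p_2)=\mathcal{R}_x(p_1)\sqcup\mathcal{R}_x(p_2)$, $\mathcal{R}_x(p_1p_2)=\mathcal{R}_x(p_1)\sqcap\mathcal{R}_x(p_2)$; $\overline{\mathcal{R}}_x(c)=(F,F,F,\neg c)$, $\overline{\mathcal{R}}_x(x)=(F,T,F,F)$, $\overline{\mathcal{R}}_x(y)=(F,F,F,\neg y)$, $\overline{\mathcal{R}}_x(\neg p)=\mathcal{R}_x(p)$, $\overline{\mathcal{R}}_x(p_1p_2)=\overline{\mathcal{R}}_x(p_1)\sqcup\overline{\mathcal{R}}_x(p_2)$, $\overline{\mathcal{R}}_x(p_1\lor p_2)=\overline{\mathcal{R}}_x(p_1)\sqcap\overline{\mathcal{R}}_x(p_2)$. **Substitution step.** For a variable equation $X\equiv G$ with $(P,N,C,M)=\mathcal{R}_X(G)$, $\mathrm{ref}(X\equiv G)$ is the equation $X\equiv P\,x\lor U(N\lor C\,x)\lor M$, with $x$ a fresh variable. For a variable equation set $\mathbf{E}$ with an equation for $X$, $\mathbf{E}[X]=\{X\equiv H\}\cup\{\mathrm{LV}(E')\equiv\mathrm{RE}(E')[H/X]\mid E'\in\mathbf{E}\setminus\{\mathbf{E}(X)\}\}$ where $X\equiv H$ is $\mathrm{ref}(\mathbf{E}(X))$; its fresh variable does not occur in any equation of $\mathbf{E}$ (on either side) and is not one of the variable arguments in $VA$. *)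

theory Defs
  imports Main
begin

datatype kleene = KF | KU | KT

instantiation kleene :: linorder
begin

definition less_eq_kleene :: "kleene \<Rightarrow> kleene \<Rightarrow> bool" where
  "a \<le> b \<longleftrightarrow> a = KF \<or> a = b \<or> b = KT"

definition less_kleene :: "kleene \<Rightarrow> kleene \<Rightarrow> bool" where
  "a < b \<longleftrightarrow> a \<le> b \<and> a \<noteq> (b :: kleene)"

instance
proof
  fix a b c :: kleene
  show "a < b \<longleftrightarrow> a \<le> b \<and> \<not> b \<le> a"
    by (cases a; cases b) (auto simp: less_eq_kleene_def less_kleene_def)
  show "a \<le> a" by (simp add: less_eq_kleene_def)
  show "a \<le> b \<Longrightarrow> b \<le> c \<Longrightarrow> a \<le> c" by (auto simp: less_eq_kleene_def)
  show "a \<le> b \<Longrightarrow> b \<le> a \<Longrightarrow> a = b" by (auto simp: less_eq_kleene_def)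
  show "a \<le> b \<or> b \<le> a" by (cases a; cases b) (auto simp: less_eq_kleene_def)
qed

end

fun kneg :: "kleene \<Rightarrow> kleene" where
  "kneg KT = KF"
| "kneg KF = KT"
| "kneg KU = KU"

datatype (vars: 'v) expr =
    Const kleene
  | Var 'v
  | Neg "'v expr"
  | And "'v expr" "'v expr"  (infixl \<open>\<^bold>\<and>\<close> 70)
  | Or "'v expr" "'v expr"  (infixl \<open>\<^bold>\<or>\<close> 65)

abbreviation "TT \<equiv> Const KT"
abbreviation "FF \<equiv> Const KF"
abbreviation "UU \<equiv> Const KU"

primrec eval :: "('v \<Rightarrow> kleene) \<Rightarrow> 'v expr \<Rightarrow> kleene" where
  "eval v (Const c) = c"
| "eval v (Var x) = v x"
| "eval v (Neg p) = kneg (eval v p)"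
| "eval v (p \<^bold>\<and> q) = min (eval v p) (eval v q)"
| "eval v (p \<^bold>\<or> q) = max (eval v p) (eval v q)"

definition equivalent :: "'v expr \<Rightarrow> 'v expr \<Rightarrow> bool"  (infix \<open>\<simeq>\<close> 50) where
  "p \<simeq> q \<longleftrightarrow> (\<forall>v. eval v p = eval v q)"

text \<open>\<open>subst p q x\<close> is \<open>p[q/x]\<close>.\<close>

primrec subst :: "'v expr \<Rightarrow> 'v expr \<Rightarrow> 'v \<Rightarrow> 'v expr" where
  "subst (Const c) q x = Const c"
| "subst (Var y) q x = (if y = x then q else Var y)"
| "subst (Neg p) q x = Neg (subst p q x)"
| "subst (p1 \<^bold>\<and> p2) q x = subst p1 q x \<^bold>\<and> subst p2 q x"
| "subst (p1 \<^bold>\<or> p2) q x = subst p1 q x \<^bold>\<or> subst p2 q x"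

text \<open>
  The notation \<open>\<And>\<^bsub>i\<in>I\<^esub> f i\<close> leaves the order and the bracketing of the conjuncts open.
  \<open>is_conj f I p\<close> says that \<open>p\<close> is one of the expressions it may denote: each index in \<open>I\<close>
  contributes exactly one conjunct, and \<open>T\<close> is used for empty \<open>I\<close> only.
\<close>

inductive is_conj :: "('i \<Rightarrow> 'v expr) \<Rightarrow> 'i set \<Rightarrow> 'v expr \<Rightarrow> bool" for f where
  empty: "is_conj f {} TT"
| single: "is_conj f {i} (f i)"
| union: "is_conj f (I \<union> J) (p \<^bold>\<and> q)"
    if "is_conj f I p" "is_conj f J q" "I \<noteq> {}" "J \<noteq> {}" "I \<inter> J = {}"

lemma is_conj_exists:
  assumes "finite I"
  shows "\<exists>p. is_conj f I p"
  using assms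
proof (induction I rule: finite_induct)
  case empty
  show ?case using is_conj.empty by blast
next
  case (insert i I)
  then obtain p where p: "is_conj f I p" by blast
  show ?case
  proof (cases "I = {}")
    case True
    then show ?thesis using is_conj.single[of f i] by auto
  next
    case False
    then have "is_conj f ({i} \<union> I) (f i \<^bold>\<and> p)"
      using is_conj.union[OF is_conj.single p] insert.hyps by auto
    then show ?thesis by auto
  qed
qed

definition block :: "'a set \<Rightarrow> 'a set \<Rightarrow> ('a \<times> 'a) set \<Rightarrow> bool" where
  "block AR VA ATT \<longleftrightarrow>
     finite AR \<and> finite VA \<and> AR \<inter> VA = {} \<and> ATT \<subseteq> (AR \<union> VA) \<times> AR"

text \<open>
  A local allocator is a total function here; only its values on \<open>AR \<union> VA\<close> are ever used.
\<close>

definition satisfies_attacks ::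
    "'a set \<Rightarrow> ('a \<times> 'a) set \<Rightarrow> ('a \<Rightarrow> 'v expr) \<Rightarrow> bool" where
  "satisfies_attacks AR ATT El \<longleftrightarrow>
     (\<forall>A\<in>AR. \<exists>p. is_conj (\<lambda>A'. Neg (El A')) {A'. (A', A) \<in> ATT} p \<and> El A \<simeq> p)"

definition complete_allocator ::
    "'a set \<Rightarrow> 'a set \<Rightarrow> ('a \<times> 'a) set \<Rightarrow> ('a \<Rightarrow> 'v expr) \<Rightarrow> bool" where
  "complete_allocator AR VA ATT El \<longleftrightarrow>
     (\<forall>V\<in>VA. \<exists>x. El V = Var x) \<and> inj_on El VA \<and> satisfies_attacks AR ATT El"

definition constant_allocator ::
    "'a set \<Rightarrow> 'a set \<Rightarrow> ('a \<times> 'a) set \<Rightarrow> ('a \<Rightarrow> 'v expr) \<Rightarrow> bool" where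
  "constant_allocator AR VA ATT El \<longleftrightarrow>
     (\<forall>A\<in>AR \<union> VA. \<exists>c. El A = Const c) \<and> satisfies_attacks AR ATT El"

definition general_allocator ::
    "'a set \<Rightarrow> 'a set \<Rightarrow> ('a \<times> 'a) set \<Rightarrow> ('a \<Rightarrow> 'v expr) \<Rightarrow> bool" where
  "general_allocator AR VA ATT El \<longleftrightarrow>
     complete_allocator AR VA ATT El \<and>
     (\<forall>El' :: 'a \<Rightarrow> 'v expr. constant_allocator AR VA ATT El' \<longrightarrow>
        (\<exists>v. \<forall>A\<in>AR \<union> VA. El' A = Const (eval v (El A))))"

text \<open>A variable equation is a pair of its left-hand variable and its right-hand expression.\<close>

type_synonym 'v equation = "'v \<times> 'v expr"

abbreviation LV :: "'v equation \<Rightarrow> 'v" where "LV \<equiv> fst"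
abbreviation RE :: "'v equation \<Rightarrow> 'v expr" where "RE \<equiv> snd"

definition equation_set :: "'v equation set \<Rightarrow> bool" where
  "equation_set E \<longleftrightarrow> inj_on LV E"

definition eqn :: "'v equation set \<Rightarrow> 'v \<Rightarrow> 'v equation" where
  "eqn E X = (THE e. e \<in> E \<and> LV e = X)"

type_synonym 'v quad = "'v expr \<times> 'v expr \<times> 'v expr \<times> 'v expr"

fun qjoin :: "'v quad \<Rightarrow> 'v quad \<Rightarrow> 'v quad" where
  "qjoin (P1, N1, C1, M1) (P2, N2, C2, M2) =
     (P1 \<^bold>\<or> P2, N1 \<^bold>\<or> N2, C1 \<^bold>\<or> C2, M1 \<^bold>\<or> M2)"

fun qmeet :: "'v quad \<Rightarrow> 'v quad \<Rightarrow> 'v quad" where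
  "qmeet (P1, N1, C1, M1) (P2, N2, C2, M2) =
     (P1 \<^bold>\<and> P2 \<^bold>\<or> P1 \<^bold>\<and> M2 \<^bold>\<or> P2 \<^bold>\<and> M1,
      N1 \<^bold>\<and> N2 \<^bold>\<or> N1 \<^bold>\<and> M2 \<^bold>\<or> N2 \<^bold>\<and> M1,
      (P1 \<^bold>\<or> N1 \<^bold>\<or> M1) \<^bold>\<and> C2 \<^bold>\<or> (P2 \<^bold>\<or> N2 \<^bold>\<or> M2) \<^bold>\<and> C1 \<^bold>\<or> C1 \<^bold>\<and> C2 \<^bold>\<or> P1 \<^bold>\<and> N2 \<^bold>\<or> N1 \<^bold>\<and> P2,
      M1 \<^bold>\<and> M2)"

fun Rpos :: "'v \<Rightarrow> 'v expr \<Rightarrow> 'v quad" and Rneg :: "'v \<Rightarrow> 'v expr \<Rightarrow> 'v quad" where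
  "Rpos x (Const c) = (FF, FF, FF, Const c)"
| "Rpos x (Var y) = (if y = x then (TT, FF, FF, FF) else (FF, FF, FF, Var y))"
| "Rpos x (Neg p) = Rneg x p"
| "Rpos x (p1 \<^bold>\<or> p2) = qjoin (Rpos x p1) (Rpos x p2)"
| "Rpos x (p1 \<^bold>\<and> p2) = qmeet (Rpos x p1) (Rpos x p2)"
| "Rneg x (Const c) = (FF, FF, FF, Neg (Const c))"
| "Rneg x (Var y) = (if y = x then (FF, TT, FF, FF) else (FF, FF, FF, Neg (Var y)))"
| "Rneg x (Neg p) = Rpos x p"
| "Rneg x (p1 \<^bold>\<and> p2) = qjoin (Rneg x p1) (Rneg x p2)"
| "Rneg x (p1 \<^bold>\<or> p2) = qmeet (Rneg x p1) (Rneg x p2)"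

text \<open>The fresh variable \<open>x\<close> is an explicit parameter of \<open>refine\<close> and \<open>subst_step\<close>.\<close>

definition refine :: "'v \<Rightarrow> 'v equation \<Rightarrow> 'v equation" where
  "refine x e =
     (case Rpos (LV e) (RE e) of
        (P, N, C, M) \<Rightarrow> (LV e, P \<^bold>\<and> Var x \<^bold>\<or> UU \<^bold>\<and> (N \<^bold>\<or> C \<^bold>\<and> Var x) \<^bold>\<or> M))"

definition fresh :: "'v set \<Rightarrow> 'v equation set \<Rightarrow> 'v \<Rightarrow> bool" where
  "fresh VA E x \<longleftrightarrow> x \<notin> VA \<and> (\<forall>e\<in>E. x \<noteq> LV e \<and> x \<notin> vars (RE e))"

definition subst_step :: "'v equation set \<Rightarrow> 'v \<Rightarrow> 'v \<Rightarrow> 'v equation set" where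
  "subst_step E X x =
     (let e = refine x (eqn E X)
      in {e} \<union> {(LV e', subst (RE e') (RE e) X) | e'. e' \<in> E - {eqn E X}})"

text \<open>
  \<open>subst_steps VA E [X1, \<dots>, Xn] E'\<close>: for some choice of fresh variables,
  \<open>E'\<close> is \<open>E[X1]\<dots>[Xn]\<close>.
\<close>

inductive subst_steps ::
    "'v set \<Rightarrow> 'v equation set \<Rightarrow> 'v list \<Rightarrow> 'v equation set \<Rightarrow> bool" for VA where
  Nil: "subst_steps VA E [] E"
| Cons: "subst_steps VA E (X # Xs) E'"
    if "X \<in> LV ` E" "fresh VA E x" "subst_steps VA (subst_step E X x) Xs E'"

lemma LV_refine [simp]: "LV (refine x e) = LV e"
  by (simp add: refine_def split: prod.split)

lemma eqn_mem:
  assumes "equation_set E" and "X \<in> LV ` E"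
  shows "eqn E X \<in> E \<and> LV (eqn E X) = X"
proof -
  have "\<exists>!e. e \<in> E \<and> LV e = X"
    using assms unfolding equation_set_def inj_on_def by blast
  then show ?thesis unfolding eqn_def by (rule theI')
qed

lemma subst_step_image:
  "subst_step E X x =
     insert (refine x (eqn E X))
       ((\<lambda>e'. (LV e', subst (RE e') (RE (refine x (eqn E X))) X)) ` (E - {eqn E X}))"
  by (simp only: subst_step_def Let_def setcompr_eq_image Collect_mem_eq insert_is_Un[symmetric])

lemma subst_step_LV:
  assumes "equation_set E" and "X \<in> LV ` E"
  shows "LV ` subst_step E X x = LV ` E"
proof -
  have "LV ` subst_step E X x = insert (LV (eqn E X)) (LV ` (E - {eqn E X}))"
    by (simp add: subst_step_image image_image)
  also have "\<dots> = LV ` E" using eqn_mem[OF assms] by blast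
  finally show ?thesis .
qed

lemma subst_step_equation_set:
  assumes "equation_set E" and "X \<in> LV ` E"
  shows "equation_set (subst_step E X x)"
proof -
  let ?e = "eqn E X"
  let ?f = "\<lambda>e'. (LV e', subst (RE e') (RE (refine x ?e)) X)"
  have inj: "inj_on LV E" using assms(1) by (simp add: equation_set_def)
  have "inj_on LV (?f ` (E - {?e}))"
    using inj_on_subset[OF inj, of "E - {?e}"]
    by (intro inj_on_imageI) (simp add: comp_def)
  moreover have "LV ?e \<notin> LV ` (E - {?e})"
    using inj_on_image_mem_iff[OF inj, of ?e "E - {?e}"] eqn_mem[OF assms] by simp
  then have "LV (refine x ?e) \<notin> LV ` (?f ` (E - {?e}))"
    by (simp add: image_image)
  then have "LV (refine x ?e) \<notin> LV ` (?f ` (E - {?e}) - {refine x ?e})"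
    by (meson Diff_subset image_mono subsetD)
  ultimately show ?thesis
    unfolding equation_set_def subst_step_image inj_on_insert by (rule conjI)
qed

lemma subst_step_finite: "finite E \<Longrightarrow> finite (subst_step E X x)"
  by (simp add: subst_step_image)

lemma finite_vars: "finite (vars p)"
  by (induction p) auto

text \<open>With infinitely many variables, \<open>E[X1]\<dots>[Xn]\<close> always exists.\<close>

lemma subst_steps_exists:
  fixes E :: "'v equation set"
  assumes "infinite (UNIV :: 'v set)" and "finite VA"
    and "finite E" and "equation_set E" and "set Xs \<subseteq> LV ` E"
  shows "\<exists>E'. subst_steps VA E Xs E'"
  using assms(3-5)
proof (induction Xs arbitrary: E)
  case Nil
  show ?case using subst_steps.Nil by blast
next
  case (Cons X Xs)
  have "finite (VA \<union> LV ` E \<union> (\<Union>e\<in>E. vars (RE e)))"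
    using assms(2) Cons.prems(1) by (auto simp: finite_vars)
  then obtain x where "x \<notin> VA \<union> LV ` E \<union> (\<Union>e\<in>E. vars (RE e))"
    using ex_new_if_finite[OF assms(1)] by metis
  then have fr: "fresh VA E x" by (auto simp: fresh_def)
  have X: "X \<in> LV ` E" using Cons.prems(3) by simp
  have "\<exists>E'. subst_steps VA (subst_step E X x) Xs E'"
  proof (rule Cons.IH)
    show "finite (subst_step E X x)" by (rule subst_step_finite[OF Cons.prems(1)])
    show "equation_set (subst_step E X x)" by (rule subst_step_equation_set[OF Cons.prems(2) X])
    show "set Xs \<subseteq> LV ` subst_step E X x"
      using Cons.prems(3) by (simp add: subst_step_LV[OF Cons.prems(2) X])
  qed
  then show ?case using subst_steps.Cons[OF X fr] by blast
qed

end

(*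
  Over distributive lattices, R_X(G) = (P, N, C, M) gives the normal form
  G = P X \<or> N \<not>X \<or> C X \<not>X \<or> M. The right-hand side H of ref(X = G) parametrises the solutions of X = G:
  H is a solution for every value of the fresh variable, and a solution X is obtained by giving the
  fresh variable the value of X itself. So a substitution step neither loses solutions nor adds any,
  up to the value of the fresh variable. After all steps the right-hand sides are free of AR, hence
  any choice of values outside AR extends to a solution of the original equations (completeness),
  and every solution of the original equations arises in this way (generality).
*)
theory Submission
  imports Defs
begin

section \<open>Kleene's three-valued connectives\<close>

lemma min_kleene:
  "min KF a = KF" "min a KF = KF" "min KT a = a" "min a KT = a" "min KU KU = KU"
  by (cases a; simp add: min_def less_eq_kleene_def)+

lemma max_kleene:
  "max KF a = a" "max a KF = a" "max KT a = KT" "max a KT = KT" "max KU KU = KU"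
  by (cases a; simp add: max_def less_eq_kleene_def)+

lemma kneg_kneg [simp]: "kneg (kneg a) = a"
  by (cases a) auto

lemma kneg_min: "kneg (min a b) = max (kneg a) (kneg b)"
  by (cases a; cases b) (simp_all add: min_kleene max_kleene)

lemma kneg_max: "kneg (max a b) = min (kneg a) (kneg b)"
  by (cases a; cases b) (simp_all add: min_kleene max_kleene)

section \<open>The normal form computed by \<open>Rpos\<close> and \<open>Rneg\<close>\<close>

definition nf :: "kleene \<Rightarrow> kleene \<Rightarrow> kleene \<Rightarrow> kleene \<Rightarrow> kleene \<Rightarrow> kleene" where
  "nf x p n c m = max (max (min p x) (min n (kneg x))) (max (min c (min x (kneg x))) m)"

text \<open>The factor \<open>min x (kneg x)\<close> is \<open>KF\<close> except at
  \<open>x = KU\<close>, so \<open>c\<close> contributes only there. Splitting on \<open>x\<close>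
  removes negation and leaves pure lattice terms.\<close>

lemma nf_simps:
  "nf KT p n c m = max p m"
  "nf KF p n c m = max n m"
  "nf KU p n c m = max (min (max (max p n) c) KU) m"
  by (cases p; cases n; cases c; cases m; simp add: nf_def min_kleene max_kleene)+

definition nf_quad :: "('v \<Rightarrow> kleene) \<Rightarrow> 'v \<Rightarrow> 'v quad \<Rightarrow> kleene" where
  "nf_quad v x q =
     (case q of (P, N, C, M) \<Rightarrow> nf (v x) (eval v P) (eval v N) (eval v C) (eval v M))"

text \<open>In a chain, testing against lower bounds \<open>t\<close> turns \<open>max\<close> into
  disjunction and \<open>min\<close> into conjunction, so identities of lattice terms become
  propositional.\<close>

lemma kleene_eqI: "(\<And>t. t \<le> a \<longleftrightarrow> t \<le> b) \<Longrightarrow> a = (b :: kleene)"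
  by (meson order_antisym order_refl)

lemma nf_quad_qjoin: "nf_quad v x (qjoin q r) = max (nf_quad v x q) (nf_quad v x r)"
proof (rule kleene_eqI)
  fix t
  obtain P N C M where q: "q = (P, N, C, M)" by (cases q)
  obtain P' N' C' M' where r: "r = (P', N', C', M')" by (cases r)
  show "t \<le> nf_quad v x (qjoin q r) \<longleftrightarrow> t \<le> max (nf_quad v x q) (nf_quad v x r)"
    by (cases "v x"; simp only: q r nf_quad_def qjoin.simps prod.case eval.simps nf_simps
        le_max_iff_disj min.bounded_iff; blast)
qed

text \<open>For each value of \<open>v x\<close> this is distributivity. The products of
  \<open>P\<close> with \<open>N'\<close> and of \<open>N\<close> with \<open>P'\<close> carry both
  \<open>x\<close> and its negation, hence belong to the third component.\<close>

lemma nf_quad_qmeet: "nf_quad v x (qmeet q r) = min (nf_quad v x q) (nf_quad v x r)"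
proof (rule kleene_eqI)
  fix t
  obtain P N C M where q: "q = (P, N, C, M)" by (cases q)
  obtain P' N' C' M' where r: "r = (P', N', C', M')" by (cases r)
  show "t \<le> nf_quad v x (qmeet q r) \<longleftrightarrow> t \<le> min (nf_quad v x q) (nf_quad v x r)"
    by (cases "v x"; simp only: q r nf_quad_def qmeet.simps prod.case eval.simps nf_simps
        le_max_iff_disj min.bounded_iff; blast)
qed

lemma nf_quad_Rpos_Rneg:
  "nf_quad v x (Rpos x p) = eval v p"
  "nf_quad v x (Rneg x p) = kneg (eval v p)"
  by (induction p)
    (auto simp: nf_quad_qjoin nf_quad_qmeet kneg_min kneg_max,
     auto simp: nf_quad_def nf_def min_kleene max_kleene)

fun qvars :: "'v quad \<Rightarrow> 'v set" where
  "qvars (P, N, C, M) = vars P \<union> vars N \<union> vars C \<union> vars M"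

lemma qvars_qjoin_qmeet:
  "qvars (qjoin q r) \<subseteq> qvars q \<union> qvars r"
  "qvars (qmeet q r) \<subseteq> qvars q \<union> qvars r"
  by (cases q; cases r; auto)+

text \<open>This is why \<open>refine\<close> removes a variable from the right-hand side of its own
  equation.\<close>

lemma qvars_Rpos_Rneg:
  "qvars (Rpos x p) \<subseteq> vars p - {x} \<and> qvars (Rneg x p) \<subseteq> vars p - {x}"
proof (induction p)
  case (And p1 p2)
  then show ?case
    using qvars_qjoin_qmeet(1)[of "Rneg x p1" "Rneg x p2"]
      qvars_qjoin_qmeet(2)[of "Rpos x p1" "Rpos x p2"] by auto
next
  case (Or p1 p2)
  then show ?case
    using qvars_qjoin_qmeet(1)[of "Rpos x p1" "Rpos x p2"]
      qvars_qjoin_qmeet(2)[of "Rneg x p1" "Rneg x p2"] by auto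
qed auto

lemma vars_refine: "vars (RE (refine x e)) \<subseteq> insert x (vars (RE e) - {LV e})"
  using qvars_Rpos_Rneg[of "LV e" "RE e"] by (auto simp: refine_def split: prod.splits)

lemma eval_cong: "(\<And>y. y \<in> vars p \<Longrightarrow> v y = w y) \<Longrightarrow> eval v p = eval w p"
  by (induction p) auto

lemma eval_fun_upd [simp]: "x \<notin> vars p \<Longrightarrow> eval (v(x := c)) p = eval v p"
  by (rule eval_cong) auto

lemma eval_subst: "eval v (subst p q x) = eval (v(x := eval v q)) p"
  by (induction p) auto

lemma vars_subst: "vars (subst p q x) \<subseteq> (vars p - {x}) \<union> vars q"
  by (induction p) auto

section \<open>Solving a single equation\<close>

definition sol :: "kleene \<Rightarrow> kleene \<Rightarrow> kleene \<Rightarrow> kleene \<Rightarrow> kleene \<Rightarrow> kleene" where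
  "sol t p n c m = max (max (min p t) (min KU (max n (min c t)))) m"

text \<open>Let \<open>a\<close> be the value of \<open>sol\<close>. If \<open>a = KT\<close>, then
  \<open>p\<close> or \<open>m\<close> is \<open>KT\<close>; if \<open>a = KF\<close>, then
  \<open>n\<close> and \<open>m\<close> are \<open>KF\<close>; if \<open>a = KU\<close>, then
  \<open>m\<close> is not \<open>KT\<close> and one of \<open>p\<close>, \<open>n\<close>,
  \<open>c\<close>, \<open>m\<close> is not \<open>KF\<close>. In each case \<open>nf_simps\<close>
  returns \<open>a\<close>.\<close>

lemma nf_sol: "nf (sol t p n c m) p n c m = sol t p n c m"
  by (cases t; cases p; cases n; cases c; cases m)
    (simp_all add: sol_def nf_simps min_kleene max_kleene)

text \<open>At \<open>KU\<close> the terms \<open>sol\<close> and \<open>nf\<close> coincide. At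
  \<open>KT\<close> the hypothesis makes \<open>p\<close> or \<open>m\<close> equal to
  \<open>KT\<close>; at \<open>KF\<close> it makes \<open>n\<close> and \<open>m\<close> equal to
  \<open>KF\<close>.\<close>

lemma sol_fixpoint: "nf x p n c m = x \<Longrightarrow> sol x p n c m = x"
  by (cases x; cases p; cases n; cases c; cases m)
    (simp_all add: sol_def nf_simps min_kleene max_kleene)

lemma refine_sound:
  assumes "v (LV e) = eval v (RE (refine x e))"
  shows "v (LV e) = eval v (RE e)"
proof -
  obtain P N C M where q: "Rpos (LV e) (RE e) = (P, N, C, M)" by (metis prod_cases4)
  have "v (LV e) = sol (v x) (eval v P) (eval v N) (eval v C) (eval v M)"
    using assms by (simp add: refine_def q sol_def)
  then have "nf (v (LV e)) (eval v P) (eval v N) (eval v C) (eval v M) = v (LV e)"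
    by (simp only: nf_sol)
  then show ?thesis
    using nf_quad_Rpos_Rneg(1)[of v "LV e" "RE e"] by (simp add: q nf_quad_def)
qed

lemma refine_complete:
  assumes "v (LV e) = eval v (RE e)" and "v x = v (LV e)"
  shows "v (LV e) = eval v (RE (refine x e))"
proof -
  obtain P N C M where q: "Rpos (LV e) (RE e) = (P, N, C, M)" by (metis prod_cases4)
  have "nf (v (LV e)) (eval v P) (eval v N) (eval v C) (eval v M) = v (LV e)"
    using nf_quad_Rpos_Rneg(1)[of v "LV e" "RE e"] assms(1) by (simp add: q nf_quad_def)
  then have "sol (v (LV e)) (eval v P) (eval v N) (eval v C) (eval v M) = v (LV e)"
    by (rule sol_fixpoint)
  then show ?thesis by (simp add: refine_def q sol_def assms(2))
qed

section \<open>Solutions and variables under one substitution step\<close>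

definition solves :: "('v \<Rightarrow> kleene) \<Rightarrow> 'v equation set \<Rightarrow> bool" where
  "solves v E \<longleftrightarrow> (\<forall>e\<in>E. v (LV e) = eval v (RE e))"

text \<open>Substituting \<open>H\<close> for \<open>X\<close> amounts to evaluating under
  \<open>v(X := eval v H)\<close>, which is \<open>v\<close> itself once the equation for
  \<open>X\<close> holds.\<close>

lemma solves_subst_step:
  assumes "equation_set E" and "X \<in> LV ` E"
  shows "solves v (subst_step E X x) \<longleftrightarrow>
    v X = eval v (RE (refine x (eqn E X))) \<and> solves v (E - {eqn E X})"
proof -
  let ?c = "eval v (RE (refine x (eqn E X)))"
  have "solves v (subst_step E X x) \<longleftrightarrow>
      v X = ?c \<and> (\<forall>e\<in>E - {eqn E X}. v (LV e) = eval (v(X := ?c)) (RE e))"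
    by (simp only: solves_def subst_step_image ball_simps LV_refine eqn_mem[OF assms]
        fst_conv snd_conv eval_subst)
  moreover have "v(X := ?c) = v" if "v X = ?c"
    using that by (rule fun_upd_idem)
  ultimately show ?thesis by (auto simp only: solves_def)
qed

lemma solves_insert_eqn:
  assumes "equation_set E" and "X \<in> LV ` E"
  shows "solves v E \<longleftrightarrow> v X = eval v (RE (eqn E X)) \<and> solves v (E - {eqn E X})"
  using eqn_mem[OF assms] by (metis DiffI DiffD1 singletonD solves_def)

lemma subst_step_sound:
  assumes "equation_set E" and "X \<in> LV ` E" and "solves v (subst_step E X x)"
  shows "solves v E"
  using assms(3) refine_sound[of v "eqn E X" x] eqn_mem[OF assms(1,2)]
  by (simp add: solves_subst_step[OF assms(1,2)] solves_insert_eqn[OF assms(1,2)])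

text \<open>The fresh variable does not occur in \<open>E\<close>, so it can be given the value of
  \<open>X\<close> without disturbing the solution.\<close>

lemma subst_step_complete:
  assumes "equation_set E" and "X \<in> LV ` E" and "fresh VA E x" and "solves v E"
  shows "solves (v(x := v X)) (subst_step E X x)"
proof -
  let ?v = "v(x := v X)"
  have "solves ?v E"
    using assms(3,4) by (auto simp: solves_def fresh_def)
  moreover have "?v x = ?v X" by simp
  ultimately show ?thesis
    using refine_complete[of ?v "eqn E X" x] eqn_mem[OF assms(1,2)]
    by (simp add: solves_subst_step[OF assms(1,2)] solves_insert_eqn[OF assms(1,2)]
        del: fun_upd_apply)
qed

text \<open>\<open>D\<close> stands for the variables eliminated so far. They are left-hand sides,
  so the fresh variable cannot reintroduce one.\<close>

lemma subst_step_vars: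
  assumes "equation_set E" and "X \<in> LV ` E" and "fresh VA E x"
    and "\<And>e. e \<in> E \<Longrightarrow> vars (RE e) \<inter> D = {}" and "D \<subseteq> LV ` E" and "e \<in> subst_step E X x"
  shows "vars (RE e) \<inter> insert X D = {}"
proof -
  let ?H = "RE (refine x (eqn E X))"
  have "x \<notin> insert X D" using assms(2,3,5) by (auto simp: fresh_def)
  moreover have "vars (RE (eqn E X)) \<inter> D = {}"
    using assms(4) eqn_mem[OF assms(1,2)] by simp
  moreover have "vars ?H \<subseteq> insert x (vars (RE (eqn E X)) - {X})"
    using vars_refine[of x "eqn E X"] eqn_mem[OF assms(1,2)] by simp
  ultimately have H: "vars ?H \<inter> insert X D = {}" by blast
  consider "e = refine x (eqn E X)" | e' where "e' \<in> E" "RE e = subst (RE e') ?H X"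
    using assms(6) unfolding subst_step_image by force
  then show ?thesis
  proof cases
    case 1
    then show ?thesis using H by (simp only:)
  next
    case 2
    have "vars (RE e) \<subseteq> (vars (RE e') - {X}) \<union> vars ?H"
      unfolding 2(2) by (rule vars_subst)
    then show ?thesis using H assms(4)[OF 2(1)] by blast
  qed
qed

section \<open>Iterated substitution steps\<close>

lemma subst_steps_equation_set:
  assumes "subst_steps VA E Xs E'" and "equation_set E"
  shows "equation_set E' \<and> LV ` E' = LV ` E"
  using assms
  by (induction rule: subst_steps.induct) (simp_all add: subst_step_equation_set subst_step_LV)

lemma subst_steps_sound:
  assumes "subst_steps VA E Xs E'" and "equation_set E" and "solves v E'"
  shows "solves v E"
  using assms
proof (induction rule: subst_steps.induct)
  case (Cons X E x Xs E')
  then have "solves v (subst_step E X x)" by (intro Cons.IH subst_step_equation_set)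
  with Cons.prems(1) Cons.hyps(1) show ?case by (rule subst_step_sound)
qed

lemma subst_steps_complete:
  assumes "subst_steps VA E Xs E'" and "equation_set E" and "solves v E"
  shows "\<exists>w. solves w E' \<and> (\<forall>y\<in>LV ` E \<union> VA. w y = v y)"
  using assms
proof (induction arbitrary: v rule: subst_steps.induct)
  case (Nil E)
  then show ?case by blast
next
  case (Cons X E x Xs E')
  let ?v = "v(x := v X)"
  have "solves ?v (subst_step E X x)"
    using Cons.prems Cons.hyps by (intro subst_step_complete)
  then obtain w where w: "solves w E'" "\<forall>y\<in>LV ` E \<union> VA. w y = ?v y"
    using Cons.IH[OF subst_step_equation_set] Cons.prems(1) Cons.hyps(1)
    unfolding subst_step_LV[OF Cons.prems(1) Cons.hyps(1)] by blast
  have "x \<notin> LV ` E \<union> VA" using Cons.hyps(2) by (auto simp: fresh_def)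
  then have "\<forall>y\<in>LV ` E \<union> VA. w y = v y" using w(2) by auto
  with w(1) show ?case by blast
qed

lemma subst_steps_vars:
  assumes "subst_steps VA E Xs E'" and "equation_set E"
    and "\<And>e. e \<in> E \<Longrightarrow> vars (RE e) \<inter> D = {}" and "D \<subseteq> LV ` E" and "e \<in> E'"
  shows "vars (RE e) \<inter> (set Xs \<union> D) = {}"
  using assms
proof (induction arbitrary: D rule: subst_steps.induct)
  case (Nil E)
  then show ?case by simp
next
  case (Cons X E x Xs E')
  \<comment> \<open>Processing \<open>X\<close> moves it from the list into the set of eliminated
    variables.\<close>
  have "vars (RE e) \<inter> (set Xs \<union> insert X D) = {}"
  proof (rule Cons.IH)
    show "equation_set (subst_step E X x)"
      using Cons by (simp add: subst_step_equation_set)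
    show "vars (RE e') \<inter> insert X D = {}" if "e' \<in> subst_step E X x" for e'
      using subst_step_vars[OF Cons.prems(1) Cons.hyps(1,2) Cons.prems(2,3) that] .
    show "insert X D \<subseteq> LV ` subst_step E X x"
      using Cons by (simp add: subst_step_LV)
  qed (fact Cons.prems)
  then show ?case by simp
qed

section \<open>Conjunctions and the general allocator\<close>

lemma le_eval_is_conj:
  "is_conj f I p \<Longrightarrow> c \<le> eval v p \<longleftrightarrow> (\<forall>i\<in>I. c \<le> eval v (f i))"
  by (induction rule: is_conj.induct) (auto simp: less_eq_kleene_def[of c KT])

text \<open>Lower bounds of a conjunction depend only on its conjuncts, so order and bracketing do
  not affect the value.\<close>

lemma eval_is_conj_cong:
  assumes "is_conj f I p" and "is_conj g I q"
    and "\<And>i. i \<in> I \<Longrightarrow> eval v (f i) = eval w (g i)"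
  shows "eval v p = eval w q"
proof -
  have "c \<le> eval v p \<longleftrightarrow> c \<le> eval w q" for c
    using assms(3) by (simp add: le_eval_is_conj[OF assms(1)] le_eval_is_conj[OF assms(2)])
  then show ?thesis by (rule kleene_eqI)
qed

theorem theorem13:
  fixes AR VA :: "'v set" and ATT :: "('v \<times> 'v) set"
    and As :: "'v list" and g :: "'v \<Rightarrow> 'v expr"
    and E :: "'v equation set" and El :: "'v \<Rightarrow> 'v expr"
  assumes "block AR VA ATT"
    and "distinct As" and "set As = AR"
    and "\<And>A. A \<in> AR \<Longrightarrow> is_conj (\<lambda>X. Neg (Var X)) {X. (X, A) \<in> ATT} (g A)"
    and "subst_steps VA {(A, g A) | A. A \<in> AR} As E"
    and "\<And>A. A \<in> AR \<Longrightarrow> El A = RE (eqn E A)"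
    and "\<And>V. V \<in> VA \<Longrightarrow> El V = Var V"
  shows "general_allocator AR VA ATT El"
proof -
  let ?E0 = "{(A, g A) | A. A \<in> AR}"
  note conj = assms(4) and El_AR = assms(6) and El_VA = assms(7)
  have att: "X \<in> AR \<union> VA" if "(X, A) \<in> ATT" for X A
    using assms(1) that unfolding block_def by blast
  have fin: "finite {X. (X, A) \<in> ATT}" for A
  proof (rule finite_subset)
    show "{X. (X, A) \<in> ATT} \<subseteq> AR \<union> VA" using att by blast
    show "finite (AR \<union> VA)" using assms(1) by (simp add: block_def)
  qed
  have disj: "AR \<inter> VA = {}" using assms(1) by (simp add: block_def)
  have E0: "equation_set ?E0" "LV ` ?E0 = AR"
    by (auto simp: equation_set_def inj_on_def image_iff)
  have solves_E0: "solves v ?E0 \<longleftrightarrow> (\<forall>A\<in>AR. v A = eval v (g A))" for v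
    by (auto simp: solves_def)
  have E: "equation_set E" "LV ` E = AR"
    using subst_steps_equation_set[OF assms(5) E0(1)] E0(2) by simp_all
  have eqnE: "eqn E A \<in> E" "LV (eqn E A) = A" if "A \<in> AR" for A
    using eqn_mem[OF E(1), of A] E(2) that by auto
  have eqn_LV: "eqn E (LV e) = e" if "e \<in> E" for e
    using eqnE[of "LV e"] E that by (auto simp: equation_set_def dest: inj_onD)
  have solves_E: "solves v E \<longleftrightarrow> (\<forall>A\<in>AR. v A = eval v (El A))" for v
  proof -
    have "eval v (El (LV e)) = eval v (RE e)" if "e \<in> E" for e
      using El_AR[of "LV e"] eqn_LV[OF that] E(2) that by auto
    then show ?thesis unfolding solves_def E(2)[symmetric] by simp
  qed
  \<comment> \<open>Elimination starts from the empty set, and \<open>As\<close> lists all of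
    \<open>AR\<close>.\<close>
  have vars_El: "vars (El A) \<inter> AR = {}" if "A \<in> AR" for A
    using subst_steps_vars[OF assms(5) E0(1), of "{}" "eqn E A"] eqnE[OF that] El_AR[OF that]
      assms(3) by simp

  have attacks: "satisfies_attacks AR ATT El"
    unfolding satisfies_attacks_def equivalent_def
  proof
    fix A assume A: "A \<in> AR"
    obtain p where p: "is_conj (\<lambda>A'. Neg (El A')) {A'. (A', A) \<in> ATT} p"
      using is_conj_exists[OF fin] by blast
    have "eval v (El A) = eval v p" for v
    proof -
      \<comment> \<open>Overwriting \<open>v\<close> on \<open>AR\<close> leaves every
        \<open>El B\<close> with \<open>B\<close> in \<open>AR\<close> unchanged, as these are free
        of \<open>AR\<close>; so \<open>w\<close> solves \<open>E\<close> and therefore the original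
        equations.\<close>
      define w where "w y = (if y \<in> AR then eval v (El y) else v y)" for y
      have w_El: "eval w (El B) = eval v (El B)" if "B \<in> AR" for B
        using vars_El[OF that] by (intro eval_cong) (auto simp: w_def)
      have w: "w B = eval v (El B)" if "B \<in> AR \<union> VA" for B
        using that disj El_VA by (auto simp: w_def)
      have "solves w E" by (simp add: solves_E w_El w)
      then have "w A = eval w (g A)"
        using subst_steps_sound[OF assms(5) E0(1)] A by (simp add: solves_E0)
      also have "\<dots> = eval v p"
        using conj[OF A] p by (rule eval_is_conj_cong) (use w[OF att] in simp)
      finally show ?thesis using w A by simp
    qed
    then show "\<exists>p. is_conj (\<lambda>A'. Neg (El A')) {A'. (A', A) \<in> ATT} p \<and>
        (\<forall>v. eval v (El A) = eval v p)"
      using p by blast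
  qed
  have "complete_allocator AR VA ATT El"
    using attacks El_VA by (auto simp: complete_allocator_def inj_on_def)
  moreover have "\<exists>v. \<forall>A\<in>AR \<union> VA. El' A = Const (eval v (El A))"
    if El': "constant_allocator AR VA ATT El'" for El' :: "'v \<Rightarrow> 'v expr"
  proof -
    \<comment> \<open>The constant allocator is read as a valuation, which turns out to solve the
      original equations.\<close>
    obtain c where c: "\<forall>A\<in>AR \<union> VA. El' A = Const (c A)"
      using El' unfolding constant_allocator_def by metis
    have "c A = eval c (g A)" if A: "A \<in> AR" for A
    proof -
      obtain p where p: "is_conj (\<lambda>A'. Neg (El' A')) {A'. (A', A) \<in> ATT} p" "El' A \<simeq> p"
        using El' A unfolding constant_allocator_def satisfies_attacks_def by blast
      have "eval c (g A) = eval c p"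
        using conj[OF A] p(1) by (rule eval_is_conj_cong) (use c[rule_format, OF att] in simp)
      also have "\<dots> = eval c (El' A)" using p(2) by (simp add: equivalent_def)
      finally show ?thesis using c A by simp
    qed
    then have "solves c ?E0" by (simp add: solves_E0)
    \<comment> \<open>\<open>v\<close> keeps the values of all arguments and supplies suitable
      values for the fresh variables.\<close>
    then obtain v where v: "solves v E" "\<forall>y\<in>AR \<union> VA. v y = c y"
      using subst_steps_complete[OF assms(5) E0(1)] unfolding E0(2) by blast
    have "c A = eval v (El A)" if A: "A \<in> AR \<union> VA" for A
    proof (cases "A \<in> AR")
      case True
      then have "v A = eval v (El A)" using v(1) unfolding solves_E by blast
      then show ?thesis using v(2) A by metis
    next
      case False
      then have "El A = Var A" using A El_VA by blast
      then show ?thesis using v(2) A by simp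
    qed
    then show ?thesis using c by metis
  qed
  ultimately show ?thesis by (simp add: general_allocator_def)
qed

end
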